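(* Let $n$ and $k$ be positive integers with $k\leq n$, and let $E_{k,n}(t)\in\mathbb{Q}[t]$ be the Ehrhart polynomial of the hypersimplex $\Delta_{k,n}$. Then the coefficients of $E_{k,n}(t)$ are positive; that is, writing $E_{k,n}(t)=\sum_{m=0}^{d} c_m t^m$ with $d=\deg E_{k,n}$, one has $c_m>0$ for every $0\leq m\leq d$.
   Context: For positive integers $k\leq n$, the $(k,n)$-hypersimplex is the polytope $\Delta_{k,n} := \{x\in [0,1]^n : \sum_{i=1}^n x_i = k\}\subset\mathbb{R}^n$. The Ehrhart polynomial of a polytope $\mathscr{P}\subset\mathbb{R}^n$ with vertices in $\mathbb{Z}^n$ is the unique polynomial $p\in\mathbb{Q}[t]$ such that $p(t)=|\mathbb{Z}^n\cap t\mathscr{P}|$ for all integers $t\geq 0$, where $t\mathscr{P}$ is the dilation of $\mathscr{P}$ by the factor $t$ with respect to the origin. *)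

theory Defs
  imports "HOL-Analysis.Analysis" "HOL-Computational_Algebra.Polynomial"
begin

definition hypersimplex :: "nat \<Rightarrow> (real ^ 'n) set" where
  "hypersimplex k = {x. (\<forall>i. 0 \<le> x $ i \<and> x $ i \<le> 1) \<and> (\<Sum>i\<in>UNIV. x $ i) = real k}"

definition integer_lattice :: "(real ^ 'n) set" where
  "integer_lattice = {x. \<forall>i. x $ i \<in> \<int>}"

definition is_ehrhart_polynomial :: "(real ^ 'n) set \<Rightarrow> rat poly \<Rightarrow> bool" where
  "is_ehrhart_polynomial P p \<longleftrightarrow>
     (\<forall>t :: nat. poly p (of_nat t) = of_nat (card (integer_lattice \<inter> (*\<^sub>R) (real t) ` P)))"

text \<open>Meaningful only for those \<open>P\<close> (such as polytopes with integral vertices) that have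
  an Ehrhart polynomial; for other \<open>P\<close> the value is unspecified.\<close>

definition ehrhart_polynomial :: "(real ^ 'n) set \<Rightarrow> rat poly" where
  "ehrhart_polynomial P = (THE p. is_ehrhart_polynomial P p)"

lemma is_ehrhart_polynomial_unique:
  assumes "is_ehrhart_polynomial P p" "is_ehrhart_polynomial P q"
  shows "p = q"
proof (rule ccontr)
  assume "p \<noteq> q"
  then have fin: "finite {x. poly (p - q) x = 0}"
    by (intro poly_roots_finite) simp
  have "range (of_nat :: nat \<Rightarrow> rat) \<subseteq> {x. poly (p - q) x = 0}"
    using assms by (auto simp: is_ehrhart_polynomial_def)
  with fin have "finite (range (of_nat :: nat \<Rightarrow> rat))"
    by (rule rev_finite_subset)
  then show False
    using finite_imageD[of "of_nat :: nat \<Rightarrow> rat" UNIV] by (simp add: inj_on_def)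
qed

lemma ehrhart_polynomial_eqI:
  assumes "is_ehrhart_polynomial P p"
  shows "ehrhart_polynomial P = p"
  unfolding ehrhart_polynomial_def
  using assms is_ehrhart_polynomial_unique by blast

end

theory Submission
  imports Defs
begin

text \<open>
  Lattice points of the dilate by \<open>t\<close> are tuples in \<open>{0..t} ^ n\<close> with sum \<open>k * t\<close>. Reading
  their number off from \<open>((1 - X ^ (t + 1)) / (1 - X)) ^ n\<close> gives
  \<open>E t = (\<Sum>j<k. (-1) ^ j * (n choose j) * (t * (k - j) - j + n - 1 choose n - 1))\<close>,
  which is a polynomial in \<open>t\<close> but has alternating signs.

  To remove the signs, regard the \<open>j\<close>-th binomial term as a polynomial \<open>B j\<close> in
  \<open>y = t * (k - j)\<close>. Then \<open>y * B j / n\<close> is the coefficient of \<open>x ^ j * z ^ n\<close> in the power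
  \<open>((1 - x * z) / (1 - z)) powr y\<close>. The logarithmic derivative of this series in \<open>z\<close> is
  \<open>y * (1 - x) / ((1 - z) * (1 - x * z))\<close>, so it depends on \<open>y\<close> only through
  \<open>w = y * (1 - x)\<close>, and its expansion in \<open>w\<close>, \<open>x\<close> and \<open>z\<close> has nonnegative coefficients,
  the weighted Lah numbers up to factorials. Thus the coefficients of \<open>y ^ (m + 1)\<close> in
  \<open>y * B j / n\<close>, collected over \<open>j\<close> into a series in \<open>x\<close>, form
  \<open>(1 - x) ^ (m + 1)\<close> times a series with nonnegative coefficients
  (\<open>ratio_power_coeff_eq_weighted_lah\<close>).

  The coefficient of \<open>t ^ m\<close> in \<open>E\<close> is the sum over \<open>j < k\<close> of \<open>(k - j) ^ m\<close> times the
  coefficient of \<open>y ^ m\<close> in \<open>B j\<close>, a convolution with the series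
  \<open>\<Sum>i\<ge>1. i ^ m * x ^ i\<close>. The latter is an Eulerian polynomial divided by \<open>(1 - x) ^ (m + 1)\<close>
  (\<open>powers_fps_mult_power\<close>). The powers of \<open>1 - x\<close> cancel, and what remains is \<open>n\<close> times the
  coefficient of \<open>x ^ k\<close> in a product of two polynomials with nonnegative coefficients
  (\<open>coeff_hypersimplex_ehrhart\<close>). For \<open>k < n\<close> and \<open>m < n\<close> the supports of the two factors are
  long enough to make it positive, and the degree is less than \<open>n\<close>; for \<open>k = n\<close> the polytope is
  a point and \<open>E = 1\<close>.
\<close>

section \<open>Lattice points of dilated hypersimplices\<close>

text \<open>
  The bound on \<open>k\<close> makes the hypersimplex nonempty, on which the case \<open>t = 0\<close> depends.
\<close>
lemma card_lattice_points_dilated_hypersimplex: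
  assumes "k \<le> CARD('n::finite)"
  shows "card (integer_lattice \<inter> (*\<^sub>R) (real t) ` (hypersimplex k :: (real ^ 'n) set)) =
     card {f :: 'n \<Rightarrow> nat. (\<forall>i. f i \<le> t) \<and> sum f UNIV = k * t}"
proof -
  let ?F = "{f :: 'n \<Rightarrow> nat. (\<forall>i. f i \<le> t) \<and> sum f UNIV = k * t}"
  have "bij_betw (\<lambda>f. \<chi> i. real (f i)) ?F (integer_lattice \<inter> (*\<^sub>R) (real t) ` (hypersimplex k :: (real ^ 'n) set))"
  proof (rule bij_betwI[where g = "\<lambda>x i. nat \<lfloor>x $ i\<rfloor>"])
    show "(\<lambda>f. \<chi> i. real (f i)) \<in> ?F \<rightarrow> integer_lattice \<inter> (*\<^sub>R) (real t) ` hypersimplex k"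
    proof
      fix f assume "f \<in> ?F"
      then have f: "\<And>i. f i \<le> t" "sum f UNIV = k * t" by auto
      \<comment> \<open>For \<open>t = 0\<close> the dilate is \<open>{0}\<close> only because the hypersimplex is nonempty; its barycentre is a witness.\<close>
      define x :: "real ^ 'n" where "x = (if t = 0 then \<chi> i. real k / CARD('n) else \<chi> i. f i / t)"
      have "(\<chi> i. real (f i)) = real t *\<^sub>R x"
        using f(1) by (auto simp: x_def vec_eq_iff)
      moreover have "x \<in> hypersimplex k"
        using f assms by (auto simp: x_def hypersimplex_def simp flip: sum_divide_distrib of_nat_sum)
      moreover have "(\<chi> i. real (f i)) \<in> integer_lattice"
        by (simp add: integer_lattice_def)
      ultimately show "(\<chi> i. real (f i)) \<in> integer_lattice \<inter> (*\<^sub>R) (real t) ` hypersimplex k"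
        by blast
    qed
    show "(\<lambda>x i. nat \<lfloor>x $ i\<rfloor>) \<in> (integer_lattice \<inter> (*\<^sub>R) (real t) ` (hypersimplex k :: (real ^ 'n) set)) \<rightarrow> ?F"
    proof
      fix x :: "real ^ 'n" assume "x \<in> integer_lattice \<inter> (*\<^sub>R) (real t) ` hypersimplex k"
      then obtain y where y: "x = real t *\<^sub>R y" "y \<in> hypersimplex k" by blast
      have x: "x $ i \<in> \<int>" for i
        using \<open>x \<in> _\<close> by (auto simp: integer_lattice_def)
      have x0: "x $ i \<ge> 0" "x $ i \<le> t" for i
        using y by (auto simp: hypersimplex_def mult_left_le)
      have fl: "real (nat \<lfloor>x $ i\<rfloor>) = x $ i" for i
        using x[of i] x0[of i] by (auto elim!: Ints_cases)
      have "real (\<Sum>i\<in>UNIV. nat \<lfloor>x $ i\<rfloor>) = real (k * t)"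
      proof -
        have "real (\<Sum>i\<in>UNIV. nat \<lfloor>x $ i\<rfloor>) = (\<Sum>i\<in>UNIV. x $ i)"
          by (simp only: of_nat_sum fl)
        also have "\<dots> = real t * (\<Sum>i\<in>UNIV. y $ i)"
          by (simp add: y(1) sum_distrib_left)
        finally show ?thesis
          using y(2) by (simp add: hypersimplex_def)
      qed
      moreover have "nat \<lfloor>x $ i\<rfloor> \<le> t" for i
        using fl[of i] x0[of i] by linarith
      ultimately show "(\<lambda>i. nat \<lfloor>x $ i\<rfloor>) \<in> ?F" by (simp only: of_nat_eq_iff) simp
    qed
    show "(\<chi> i. real (nat \<lfloor>x $ i\<rfloor>)) = x" if "x \<in> integer_lattice \<inter> (*\<^sub>R) (real t) ` (hypersimplex k :: (real ^ 'n) set)" for x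
    proof -
      have "x $ i \<in> \<int>" "x $ i \<ge> 0" for i
        using that by (auto simp: hypersimplex_def integer_lattice_def)
      then have "real (nat \<lfloor>x $ i\<rfloor>) = x $ i" for i
        by (metis Ints_cases floor_of_int of_nat_nat of_int_0_le_iff of_int_of_nat_eq)
      then show ?thesis by (simp add: vec_eq_iff)
    qed
  qed simp
  then show ?thesis by (simp add: bij_betw_same_card)
qed

text \<open>
  Expanding the power of \<open>1 + X + \<dots> + X ^ t\<close> chooses one exponent
  in \<open>{0..t}\<close> for each coordinate.
\<close>
lemma fps_nth_power_geometric:
  "fps_nth ((\<Sum>v\<le>t. fps_X ^ v) ^ CARD('n::finite)) s =
     (of_nat (card {f :: 'n \<Rightarrow> nat. (\<forall>i. f i \<le> t) \<and> sum f UNIV = s}) :: rat)"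
proof -
  let ?P = "PiE (UNIV :: 'n set) (\<lambda>_. {..t})"
  have fin: "finite ?P" by (intro finite_PiE) auto
  have "(\<Sum>v\<le>t. fps_X ^ v :: rat fps) ^ CARD('n) = (\<Prod>i\<in>(UNIV::'n set). \<Sum>v\<le>t. fps_X ^ v)"
    by simp
  also have "\<dots> = (\<Sum>f\<in>?P. \<Prod>i\<in>UNIV. fps_X ^ f i)"
    by (rule prod_sum_PiE) auto
  also have "\<dots> = (\<Sum>f\<in>?P. fps_X ^ sum f UNIV)"
    by (simp add: power_sum)
  finally have "fps_nth ((\<Sum>v\<le>t. fps_X ^ v :: rat fps) ^ CARD('n)) s =
     (\<Sum>f\<in>?P. of_bool (sum f UNIV = s))"
    by (simp add: fps_sum_nth of_bool_def eq_commute)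
  also have "\<dots> = of_nat (card (?P \<inter> {f. sum f UNIV = s}))"
    using fin by simp
  also have "?P \<inter> {f. sum f UNIV = s} = {f. (\<forall>i. f i \<le> t) \<and> sum f UNIV = s}"
    by (auto simp: PiE_def)
  finally show ?thesis .
qed

text \<open>
  The geometric sum is \<open>(1 - X ^ (t + 1)) / (1 - X)\<close>; the numerator contributes the
  alternating binomial sum and the denominator the stars-and-bars numbers.
\<close>
lemma fps_nth_power_geometric_alternating:
  assumes "n \<ge> 1"
  shows "fps_nth ((\<Sum>v\<le>t. fps_X ^ v :: rat fps) ^ n) s =
    (\<Sum>j\<le>n. if j * Suc t \<le> s then (-1) ^ j * of_nat (n choose j) *
        of_nat ((s - j * Suc t + n - 1) choose (n - 1)) else 0)"
proof -
  let ?X = "fps_X :: rat fps"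
  have inv: "inverse ((1 - ?X) ^ n) = Abs_fps (\<lambda>i. of_nat ((i + n - 1) choose (n - 1)))"
  proof -
    have "inverse ((1 - ?X) ^ n) = Abs_fps (\<lambda>k. of_nat ((n + k - 1) choose k))"
      using one_minus_const_fps_X_neg_power'[of n 1] assms by simp
    also have "\<dots> = Abs_fps (\<lambda>i. of_nat ((i + n - 1) choose (n - 1)))"
    proof -
      have "(n + k - 1) choose k = (k + n - 1) choose (n - 1)" for k
        using binomial_symmetric[of k "n + k - 1"] assms by (simp add: add.commute)
      then show ?thesis by simp
    qed
    finally show ?thesis .
  qed
  have geo: "(1 - ?X) * (\<Sum>v\<le>t. ?X ^ v) = 1 - ?X ^ Suc t"
    using one_diff_power_eq[of ?X "Suc t"] by (simp only: lessThan_Suc_atMost)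
  have inv_mult: "inverse ((1 - ?X) ^ n) * (1 - ?X) ^ n = 1"
    by (rule inverse_mult_eq_1) (simp add: fps_power_zeroth)
  have "(\<Sum>v\<le>t. ?X ^ v) ^ n = inverse ((1 - ?X) ^ n) * (1 - ?X) ^ n * (\<Sum>v\<le>t. ?X ^ v) ^ n"
    by (simp only: inv_mult mult_1_left)
  also have "\<dots> = inverse ((1 - ?X) ^ n) * (1 - ?X ^ Suc t) ^ n"
    by (simp only: mult.assoc geo [symmetric] power_mult_distrib)
  also have "(1 - ?X ^ Suc t) ^ n = (\<Sum>j\<le>n. fps_const ((-1) ^ j * of_nat (n choose j)) * ?X ^ (j * Suc t))"
  proof -
    have "(1 - ?X ^ Suc t) ^ n = (- (?X ^ Suc t) + 1) ^ n" by simp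
    also have "\<dots> = (\<Sum>j\<le>n. of_nat (n choose j) * (- (?X ^ Suc t)) ^ j * 1 ^ (n - j))"
      by (rule binomial_ring)
    also have "\<dots> = (\<Sum>j\<le>n. fps_const ((-1) ^ j * of_nat (n choose j)) * ?X ^ (j * Suc t))"
    proof (rule sum.cong[OF refl])
      fix j
      have "- (?X ^ Suc t) = fps_const (-1) * ?X ^ Suc t"
        by (rule fps_ext) simp
      then have "(- (?X ^ Suc t)) ^ j = fps_const ((-1) ^ j) * ?X ^ (j * Suc t)"
        by (simp only: power_mult_distrib fps_const_power power_mult [symmetric] mult.commute [of "Suc t" j])
      then show "of_nat (n choose j) * (- (?X ^ Suc t)) ^ j * 1 ^ (n - j) =
          fps_const ((-1) ^ j * of_nat (n choose j)) * ?X ^ (j * Suc t)"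
        by (simp only: power_one mult_1_left mult_1_right fps_const_mult [symmetric] fps_of_nat [symmetric] mult_ac)
    qed
    finally show ?thesis .
  qed
  finally have "(\<Sum>v\<le>t. ?X ^ v) ^ n = (\<Sum>j\<le>n. fps_const ((-1) ^ j * of_nat (n choose j)) *
      (inverse ((1 - ?X) ^ n) * ?X ^ (j * Suc t)))"
    by (simp only: sum_distrib_left mult_ac)
  then show ?thesis
    unfolding inv
    by (simp add: fps_sum_nth fps_X_power_mult_right_nth del: mult_Suc_right) (auto intro!: sum.cong)
qed


section \<open>The Ehrhart polynomial by inclusion and exclusion\<close>

text \<open>
  The polynomial \<open>(-1) ^ j * (n choose j) * (y - j + n - 1 choose n - 1)\<close> in \<open>y\<close>, one
  term of the inclusion-exclusion formula. Splitting the product of the \<open>n - 1\<close> linear factors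
  at \<open>y\<close> into a falling and a rising part makes it comparable with the generating function of
  the next section; \<open>pochhammer (- y) j\<close> is \<open>(-1) ^ j\<close> times a falling factorial.
\<close>
definition signed_binomial_poly :: "nat \<Rightarrow> nat \<Rightarrow> rat poly" where
  "signed_binomial_poly n j = smult (of_nat n / (fact j * fact (n - j)))
     (pochhammer (- [:0, 1:]) j * pochhammer [:1, 1:] (n - 1 - j))"

definition hypersimplex_ehrhart :: "nat \<Rightarrow> nat \<Rightarrow> rat poly" where
  "hypersimplex_ehrhart n k = (\<Sum>j<k. pcompose (signed_binomial_poly n j) [:0, of_nat (k - j):])"

lemma poly_pochhammer: "poly (pochhammer p j) y = pochhammer (poly p y) j" for p :: "'a :: comm_ring_1 poly"
  by (induction j) (simp_all add: pochhammer_Suc)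

text \<open>
  The truncated subtraction is exact, because \<open>j \<le> n - 1\<close>.
\<close>
lemma poly_signed_binomial_poly:
  assumes "j < n"
  shows "poly (signed_binomial_poly n j) (of_nat N) =
    (-1) ^ j * of_nat (n choose j) * of_nat ((N + (n - 1) - j) choose (n - 1))"
proof -
  let ?y = "of_nat N :: rat"
  have "pochhammer (- ?y) j * pochhammer (?y + 1) (n - 1 - j) =
      (-1) ^ j * (pochhammer (?y - of_nat j + 1) j * pochhammer (?y - of_nat j + 1 + of_nat j) (n - 1 - j))"
    by (simp add: pochhammer_minus)
  also have "\<dots> = (-1) ^ j * pochhammer (?y - of_nat j + 1) (n - 1)"
    using assms by (subst pochhammer_product' [symmetric]) simp
  also have "pochhammer (?y - of_nat j + 1) (n - 1) = fact (n - 1) * (of_nat (N + (n - 1) - j) gchoose (n - 1))"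
    using assms by (simp add: gbinomial_pochhammer' of_nat_diff algebra_simps)
  finally have "pochhammer (- ?y) j * pochhammer (?y + 1) (n - 1 - j) =
     (-1) ^ j * fact (n - 1) * of_nat ((N + (n - 1) - j) choose (n - 1))"
    by (simp add: binomial_gbinomial)
  note P = this
  have C: "of_nat n * fact (n - 1) / (fact j * fact (n - j)) = (of_nat (n choose j) :: rat)"
    using assms by (subst binomial_fact) (auto simp: fact_reduce[of n])
  have "poly (signed_binomial_poly n j) ?y =
      of_nat n / (fact j * fact (n - j)) * (pochhammer (- ?y) j * pochhammer (?y + 1) (n - 1 - j))"
    by (simp add: signed_binomial_poly_def poly_pochhammer add.commute[of 1])
  also have "\<dots> = of_nat n * fact (n - 1) / (fact j * fact (n - j)) *
      ((-1) ^ j * of_nat ((N + (n - 1) - j) choose (n - 1)))"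
    unfolding P by simp
  finally show ?thesis
    unfolding C by (simp only: mult_ac)
qed

text \<open>
  The counting formula sums over the \<open>j\<close> with \<open>j * (t + 1) \<le> k * t\<close>, a range that
  depends on \<open>t\<close>. It can be replaced by the fixed range \<open>j < k\<close>: the additional terms have a
  vanishing binomial coefficient.
\<close>
lemma is_ehrhart_polynomial_hypersimplex_ehrhart:
  assumes "1 \<le> k" "k \<le> CARD('n::finite)"
  shows "is_ehrhart_polynomial (hypersimplex k :: (real ^ 'n) set) (hypersimplex_ehrhart CARD('n) k)"
  unfolding is_ehrhart_polynomial_def
proof
  fix t :: nat
  let ?n = "CARD('n)"
  let ?T = "\<lambda>j. if j * Suc t \<le> k * t then (-1) ^ j * of_nat (?n choose j) *
        of_nat ((k * t - j * Suc t + ?n - 1) choose (?n - 1)) else (0 :: rat)"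
  let ?U = "\<lambda>j. (-1 :: rat) ^ j * of_nat (?n choose j) *
        of_nat (((k - j) * t + (?n - 1) - j) choose (?n - 1))"
  have "of_nat (card (integer_lattice \<inter> (*\<^sub>R) (real t) ` (hypersimplex k :: (real ^ 'n) set))) =
    (\<Sum>j\<le>?n. ?T j)"
    using assms by (simp only: card_lattice_points_dilated_hypersimplex
      fps_nth_power_geometric [symmetric] fps_nth_power_geometric_alternating)
  also have "\<dots> = (\<Sum>j<k. ?U j)"
  proof (rule sum.mono_neutral_cong_right)
    show "\<forall>j\<in>{..?n} - {..<k}. ?T j = 0"
    proof
      fix j assume "j \<in> {..?n} - {..<k}"
      then have "k \<le> j" by simp
      \<comment> \<open>Here \<open>j \<ge> k \<ge> 1\<close>, so the exponent of the numerator already exceeds \<open>k * t\<close>.\<close>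
      then have "k * t \<le> j * t" by (rule mult_le_mono1)
      then have "k * t < j * Suc t"
        using \<open>k \<le> j\<close> assms unfolding mult_Suc_right by linarith
      then show "?T j = 0" by simp
    qed
    fix j assume j: "j \<in> {..<k}"
    have kt: "k * t = (k - j) * t + j * t" using j by (simp flip: distrib_right)
    show "?T j = ?U j"
    proof (cases "j \<le> (k - j) * t")
      case True
      then have "j * Suc t \<le> k * t" "k * t - j * Suc t + ?n - 1 = (k - j) * t + (?n - 1) - j"
        using assms kt by simp_all
      then show ?thesis by simp
    next
      case False
      \<comment> \<open>The upper index of the binomial coefficient has dropped below \<open>?n - 1\<close> but, as \<open>j < ?n\<close>, not below \<open>0\<close>: the polynomial vanishes here as well.\<close>
      then have "\<not> j * Suc t \<le> k * t" "(k - j) * t + (?n - 1) - j < ?n - 1"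
        using assms j kt by auto
      then show ?thesis by (simp only: binomial_eq_0) simp
    qed
  qed (use assms in auto)
  also have "\<dots> = (\<Sum>j<k. poly (signed_binomial_poly ?n j) (of_nat ((k - j) * t)))"
    using assms by (intro sum.cong refl) (simp only: poly_signed_binomial_poly lessThan_iff)
  also have "\<dots> = poly (hypersimplex_ehrhart ?n k) (of_nat t)"
    by (simp add: hypersimplex_ehrhart_def poly_sum poly_pcompose mult.commute)
  finally show "poly (hypersimplex_ehrhart ?n k) (of_nat t) =
     of_nat (card (integer_lattice \<inter> (*\<^sub>R) (real t) ` (hypersimplex k :: (real ^ 'n) set)))" by simp
qed

text \<open>
  The hypersimplex with \<open>k = n\<close> is the single point with all coordinates \<open>1\<close>.
\<close>
lemma is_ehrhart_polynomial_hypersimplex_full: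
  "is_ehrhart_polynomial (hypersimplex CARD('n) :: (real ^ 'n::finite) set) 1"
  unfolding is_ehrhart_polynomial_def
proof
  fix t :: nat
  have "{f :: 'n \<Rightarrow> nat. (\<forall>i. f i \<le> t) \<and> sum f UNIV = CARD('n) * t} = {\<lambda>_. t}"
  proof (intro equalityI subsetI)
    fix f :: "'n \<Rightarrow> nat" assume "f \<in> {f. (\<forall>i. f i \<le> t) \<and> sum f UNIV = CARD('n) * t}"
    then have "\<And>i. f i \<le> t" "sum f UNIV = (\<Sum>i\<in>(UNIV::'n set). t)" by auto
    then have "f i = t" for i
      using sum_mono_inv[of f UNIV "\<lambda>_. t" i] by auto
    then show "f \<in> {\<lambda>_. t}" by auto
  qed auto
  then show "poly 1 (of_nat t) = (of_nat (card (integer_lattice \<inter> (*\<^sub>R) (real t) ` (hypersimplex CARD('n) :: (real ^ 'n) set))) :: rat)"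
    by (simp add: card_lattice_points_dilated_hypersimplex)
qed


section \<open>Weighted Lah numbers\<close>

text \<open>
  The coefficient of \<open>w ^ m * z ^ n\<close> in \<open>exp (w * L z)\<close>, a power series (in fact a
  polynomial) in \<open>x\<close>, where \<open>L z\<close> is the sum of
  \<open>(1 + x + \<dots> + x ^ (b - 1)) * z ^ b / b\<close> over \<open>b \<ge> 1\<close>; the recursion extracts the
  coefficients of the derivative \<open>w * L' z * exp (w * L z)\<close>. Times \<open>fact n\<close> these are the
  weighted Lah numbers: they count the partitions of an \<open>n\<close>-element ordered set into \<open>m\<close>
  linearly ordered blocks, where \<open>x\<close> marks the elements that are smaller than the first element
  of their block.
\<close>
fun weighted_lah :: "nat \<Rightarrow> nat \<Rightarrow> rat fps" where
  "weighted_lah n 0 = of_bool (n = 0)"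
| "weighted_lah 0 (Suc m) = 0"
| "weighted_lah (Suc n) (Suc m) = fps_const (1 / of_nat (Suc n)) *
     (\<Sum>b\<le>n. (\<Sum>l\<le>b. fps_X ^ l) * weighted_lah (n - b) m)"

lemma fps_nth_geometric_sum: "fps_nth (\<Sum>l\<le>b. fps_X ^ l :: rat fps) i = of_bool (i \<le> b)"
  by (simp add: fps_sum_nth)

lemma weighted_lah_nonneg: "fps_nth (weighted_lah n m) l \<ge> 0"
proof (induction n m arbitrary: l rule: weighted_lah.induct)
  case (3 n m)
  show ?case
    unfolding weighted_lah.simps fps_mult_left_const_nth fps_sum_nth
    by (intro mult_nonneg_nonneg sum_nonneg) (auto simp: fps_mult_nth fps_nth_geometric_sum 3 intro!: sum_nonneg)
qed auto

lemma weighted_lah_pos: "1 \<le> m \<Longrightarrow> l + m \<le> n \<Longrightarrow> fps_nth (weighted_lah n m) l > 0"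
proof (induction n m arbitrary: l rule: weighted_lah.induct)
  case (3 n m)
  have nn: "fps_nth ((\<Sum>l\<le>b. fps_X ^ l) * weighted_lah (n - b) m) l \<ge> 0" for b
    by (auto simp: fps_mult_nth fps_nth_geometric_sum weighted_lah_nonneg intro!: sum_nonneg)
  have "\<exists>b\<le>n. fps_nth ((\<Sum>l\<le>b. fps_X ^ l) * weighted_lah (n - b) m) l > 0"
  proof (cases "m = 0")
    case True
    \<comment> \<open>Only \<open>b = n\<close> contributes when \<open>m = 0\<close>.\<close>
    then show ?thesis using 3 by (intro exI[of _ n]) (simp add: fps_nth_geometric_sum)
  next
    case False
    \<comment> \<open>The summand \<open>b = 0\<close> is \<open>weighted_lah n m\<close>, to which the induction hypothesis applies as \<open>l + m \<le> n\<close>.\<close>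
    then have "fps_nth (weighted_lah n m) l > 0" using "3.IH"[of 0 l] "3.prems" by simp
    then show ?thesis by (intro exI[of _ 0]) simp
  qed
  then obtain b where "b \<le> n" "fps_nth ((\<Sum>l\<le>b. fps_X ^ l) * weighted_lah (n - b) m) l > 0" by blast
  then have "(\<Sum>b\<le>n. fps_nth ((\<Sum>l\<le>b. fps_X ^ l) * weighted_lah (n - b) m) l) > 0"
    using nn by (intro sum_pos2[of _ b]) auto
  then show ?case unfolding weighted_lah.simps fps_mult_left_const_nth fps_sum_nth
    by (intro mult_pos_pos) auto
qed auto

lemma weighted_lah_eq_0: "n < m \<Longrightarrow> weighted_lah n m = 0"
  by (induction n m rule: weighted_lah.induct) auto


section \<open>Powers of (1 - xz) / (1 - z)\<close>

text \<open>
  The hypotheses say that \<open>A\<close> and \<open>B\<close> satisfy the differential equations of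
  \<open>(1 - x * z) powr y\<close> and \<open>(1 - z) powr (- y)\<close>. The logarithmic derivative of the product is
  \<open>y / (1 - z) - x * y / (1 - x * z) = y * (1 - x) / ((1 - z) * (1 - x * z))\<close>, and the
  expansion of \<open>1 / ((1 - z) * (1 - x * z))\<close> has the nonnegative coefficients
  \<open>1 + x + \<dots> + x ^ b\<close>. Working with the coefficient recurrences keeps the statement valid
  over a commutative ring, in particular one whose elements are polynomials in \<open>y\<close>.
\<close>
lemma product_ode_recurrence:
  fixes A B :: "'a :: comm_ring_1 fps"
  assumes A: "\<And>j. of_nat (Suc j) * fps_nth A (Suc j) = x * (of_nat j - y) * fps_nth A j"
    and B: "\<And>j. of_nat (Suc j) * fps_nth B (Suc j) = (of_nat j + y) * fps_nth B j"
  shows "of_nat (Suc n) * fps_nth (A * B) (Suc n) =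
    y * (1 - x) * (\<Sum>b\<le>n. (\<Sum>l\<le>b. x ^ l) * fps_nth (A * B) (n - b))"
proof -
  let ?x = "fps_const x" and ?y = "fps_const y" and ?z = fps_X
  \<comment> \<open>\<open>?S\<close> is the expansion of \<open>1 / ((1 - z) * (1 - x * z))\<close>.\<close>
  let ?S = "Abs_fps (\<lambda>b. \<Sum>l\<le>b. x ^ l)"
  have dA: "(1 - ?x * ?z) * fps_deriv A = - ?x * ?y * A"
  proof (rule fps_ext)
    fix i show "fps_nth ((1 - ?x * ?z) * fps_deriv A) i = fps_nth (- ?x * ?y * A) i"
      using A[of i] by (cases i) (simp_all add: algebra_simps del: of_nat_Suc)
  qed
  have dB: "(1 - ?z) * fps_deriv B = ?y * B"
  proof (rule fps_ext)
    fix i show "fps_nth ((1 - ?z) * fps_deriv B) i = fps_nth (?y * B) i"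
      using B[of i] by (cases i) (simp_all add: algebra_simps del: of_nat_Suc)
  qed
  have S: "?S * ((1 - ?z) * (1 - ?x * ?z)) = 1"
  proof -
    have "?S * (1 - ?z) = Abs_fps (\<lambda>b. x ^ b)"
    proof (rule fps_ext)
      fix i show "fps_nth (?S * (1 - ?z)) i = fps_nth (Abs_fps (\<lambda>b. x ^ b)) i"
        by (cases i) (simp_all add: algebra_simps)
    qed
    moreover have "Abs_fps (\<lambda>b. x ^ b) * (1 - ?x * ?z) = 1"
    proof (rule fps_ext)
      fix i show "fps_nth (Abs_fps (\<lambda>b. x ^ b) * (1 - ?x * ?z)) i = fps_nth 1 i"
        by (cases i) (simp_all add: algebra_simps)
    qed
    ultimately show ?thesis by (simp flip: mult.assoc)
  qed
  have "(1 - ?z) * (1 - ?x * ?z) * fps_deriv (A * B) =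
     (1 - ?x * ?z) * A * ((1 - ?z) * fps_deriv B) + (1 - ?z) * B * ((1 - ?x * ?z) * fps_deriv A)"
    by (simp add: algebra_simps)
  also have "\<dots> = ?y * (1 - ?x) * (A * B)"
  proof -
    have "(1 - u * z) * p * (v * q) + (1 - z) * q * (- u * v * p) = v * (1 - u) * (p * q)"
      for u v z p q :: "'a fps" by (simp add: algebra_simps)
    then show ?thesis unfolding dA dB .
  qed
  finally have ode: "(1 - ?z) * (1 - ?x * ?z) * fps_deriv (A * B) = ?y * (1 - ?x) * (A * B)" .
  have y: "?y * (1 - ?x) = fps_const (y * (1 - x))"
    by (simp add: algebra_simps)
  from arg_cong[OF ode, of "(*) ?S"]
  have "?S * ((1 - ?z) * (1 - ?x * ?z)) * fps_deriv (A * B) = ?y * (1 - ?x) * (?S * (A * B))"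
    by (simp only: mult_ac)
  then have "fps_deriv (A * B) = fps_const (y * (1 - x)) * (?S * (A * B))"
    unfolding S by (simp only: mult_1_left y)
  then have "fps_nth (fps_deriv (A * B)) n = y * (1 - x) * fps_nth (?S * (A * B)) n"
    by simp
  then show ?thesis
    by (simp add: fps_mult_nth[of "?S"] atLeast0AtMost del: of_nat_Suc fps_deriv_mult)
qed

text \<open>
  The coefficient of \<open>x ^ j * z ^ n\<close> in \<open>((1 - x * z) / (1 - z)) powr y\<close>, a polynomial
  in \<open>y\<close>: it is the product of the coefficient of \<open>z ^ j\<close> in \<open>(1 - z) powr y\<close> and
  that of \<open>z ^ (n - j)\<close> in \<open>(1 - z) powr (- y)\<close>.
\<close>
definition ratio_power_coeff :: "nat \<Rightarrow> nat \<Rightarrow> rat poly" where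
  "ratio_power_coeff n j = smult (1 / (fact j * fact (n - j)))
     (pochhammer (- [:0, 1:]) j * pochhammer [:0, 1:] (n - j))"

abbreviation fps_poly_of :: "rat poly \<Rightarrow> rat fps poly" where
  "fps_poly_of \<equiv> map_poly fps_const"

lemma fps_const_sum: "fps_const (sum f S) = (\<Sum>x\<in>S. fps_const (f x))"
  by (rule fps_ext) (simp add: fps_sum_nth)

lemma fps_poly_of_mult: "fps_poly_of (p * q) = fps_poly_of p * fps_poly_of q"
  by (intro poly_eqI) (simp add: coeff_map_poly coeff_mult fps_const_sum flip: fps_const_mult)

lemma fps_poly_of_smult: "fps_poly_of (smult c p) = smult (fps_const c) (fps_poly_of p)"
  by (intro poly_eqI) (simp add: coeff_map_poly)

text \<open>
  This is where the signs disappear. The exponent \<open>y\<close> enters the recurrence for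
  \<open>((1 - x * z) / (1 - z)) powr y\<close> only through the product \<open>w = y * (1 - x)\<close>, and in terms
  of \<open>w\<close> it is the sign-free recurrence of \<^const>\<open>weighted_lah\<close>. So each power of \<open>y\<close> carries
  the same power of \<open>1 - x\<close>.
\<close>
lemma ratio_power_coeff_eq_weighted_lah:
  "Abs_fps (\<lambda>j. if j \<le> n then coeff (ratio_power_coeff n j) m else 0) = (1 - fps_X) ^ m * weighted_lah n m"
proof -
  define u where "u j = (fps_const (1 / fact j) :: rat fps)" for j
  define a where "a j = smult (fps_X ^ j) (smult (u j) (fps_poly_of (pochhammer (- [:0, 1:]) j)))" for j
  define b where "b j = smult (u j) (fps_poly_of (pochhammer [:0, 1:] j))" for j
  \<comment> \<open>\<open>F n\<close> is the coefficient of \<open>z ^ n\<close> in \<open>((1 - x * z) / (1 - z)) powr y\<close>, as a polynomial in \<open>y\<close> over the power series in \<open>x\<close>.\<close>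
  define F where "F n = fps_nth (Abs_fps a * Abs_fps b) n" for n
  let ?x = "[:fps_X:] :: rat fps poly" and ?y = "[:0, 1:] :: rat fps poly"
  have u: "u j = of_nat (Suc j) * u (Suc j)" for j
    by (simp add: u_def del: of_nat_Suc flip: fps_of_nat)
  have fps_poly_of_linear: "fps_poly_of (p * [:of_nat c, d:]) = (of_nat c + smult (fps_const d) ?y) * fps_poly_of p" for p c d
    by (intro poly_eqI)
      (simp add: coeff_map_poly coeff_pCons of_nat_poly algebra_simps flip: fps_of_nat split: nat.split)
  have a: "of_nat (Suc j) * a (Suc j) = ?x * (of_nat j - ?y) * a j" for j
  proof -
    have "pochhammer (- [:0, 1:]) (Suc j) = pochhammer (- [:0, 1:]) j * [:of_nat j, -1 :: rat:]"
      by (simp add: pochhammer_Suc of_nat_poly)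
    then have "fps_poly_of (pochhammer (- [:0, 1:]) (Suc j)) = (of_nat j - ?y) * fps_poly_of (pochhammer (- [:0, 1:]) j)"
      by (simp only: fps_poly_of_linear) simp
    then show ?thesis
      by (simp add: a_def u[of j] of_nat_poly smult_add_right mult_ac del: of_nat_Suc)
  qed
  have b: "of_nat (Suc j) * b (Suc j) = (of_nat j + ?y) * b j" for j
  proof -
    have "pochhammer [:0, 1:] (Suc j) = pochhammer [:0, 1:] j * [:of_nat j, 1 :: rat:]"
      by (simp add: pochhammer_Suc of_nat_poly)
    then have "fps_poly_of (pochhammer [:0, 1:] (Suc j)) = (of_nat j + ?y) * fps_poly_of (pochhammer [:0, 1:] j)"
      by (simp only: fps_poly_of_linear) simp
    then show ?thesis
      by (simp add: b_def u[of j] of_nat_poly mult_ac del: of_nat_Suc)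
  qed
  have rec: "of_nat (Suc n) * F (Suc n) = ?y * (1 - ?x) * (\<Sum>b\<le>n. (\<Sum>l\<le>b. ?x ^ l) * F (n - b))" for n
    unfolding F_def by (rule product_ode_recurrence) (simp_all only: fps_nth_Abs_fps a b)
  have geo: "(\<Sum>l\<le>b. ?x ^ l) = [:\<Sum>l\<le>b. fps_X ^ l:]" for b
    by (induction b) (simp_all add: poly_const_pow flip: one_pCons)
  \<comment> \<open>The factor \<open>y * (1 - x)\<close> raises the degree in \<open>y\<close> by one and supplies one power of \<open>1 - x\<close>.\<close>
  have rec_coeff: "of_nat (Suc n) * coeff (F (Suc n)) m =
      (case m of 0 \<Rightarrow> 0 | Suc m \<Rightarrow> (1 - fps_X) * (\<Sum>b\<le>n. (\<Sum>l\<le>b. fps_X ^ l) * coeff (F (n - b)) m))" for n m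
  proof -
    have "of_nat (Suc n) * coeff (F (Suc n)) m = coeff (of_nat (Suc n) * F (Suc n)) m"
      by (simp add: of_nat_poly del: of_nat_Suc)
    also have "of_nat (Suc n) * F (Suc n) = pCons 0 (smult (1 - fps_X) (\<Sum>b\<le>n. smult (\<Sum>l\<le>b. fps_X ^ l) (F (n - b))))"
      unfolding rec geo by (simp add: one_pCons)
    finally show ?thesis by (simp add: coeff_pCons coeff_sum split: nat.split)
  qed
  have F0: "F 0 = 1"
    by (simp add: F_def a_def b_def u_def)
  have "coeff (F n) m = (1 - fps_X) ^ m * weighted_lah n m"
  proof (induction m arbitrary: n)
    case 0
    show ?case using F0 rec_coeff[of _ 0] by (cases n) (simp_all del: of_nat_Suc)
  next
    case (Suc m)
    show ?case
    proof (cases n)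
      case 0
      then show ?thesis by (simp add: F0)
    next
      case n: (Suc n')
      have "fps_const (of_nat (Suc n')) * coeff (F n) (Suc m) =
        (1 - fps_X) ^ Suc m * (\<Sum>b\<le>n'. (\<Sum>l\<le>b. fps_X ^ l) * weighted_lah (n' - b) m)"
        using rec_coeff[of n' "Suc m"] unfolding n fps_of_nat
        by (simp add: Suc.IH sum_distrib_left mult_ac del: of_nat_Suc)
      then have "fps_const (1 / of_nat (Suc n')) * (fps_const (of_nat (Suc n')) * coeff (F n) (Suc m)) =
        (1 - fps_X) ^ Suc m * weighted_lah n (Suc m)"
        by (simp only: n weighted_lah.simps mult_ac)
      then show ?thesis by (simp flip: mult.assoc del: of_nat_Suc)
    qed
  qed
  moreover have "coeff (F n) m = Abs_fps (\<lambda>j. if j \<le> n then coeff (ratio_power_coeff n j) m else 0)"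
  proof -
    have "fps_const (1 / (fact j * fact (n - j))) = u j * u (n - j)" for j
      by (simp add: u_def)
    then have "a j * b (n - j) = smult (fps_X ^ j) (fps_poly_of (ratio_power_coeff n j))" for j
      unfolding a_def b_def ratio_power_coeff_def by (simp add: fps_poly_of_smult fps_poly_of_mult mult_ac)
    then have "coeff (F n) m = (\<Sum>j\<le>n. fps_X ^ j * fps_const (coeff (ratio_power_coeff n j) m))"
      by (simp add: F_def fps_mult_nth coeff_sum coeff_map_poly atLeast0AtMost)
    moreover have "fps_nth (fps_X ^ j * fps_const c) i = (if i = j then c else 0)" for i j and c :: rat
      by simp
    ultimately show ?thesis
      by (intro fps_ext) (simp add: fps_sum_nth)
  qed
  ultimately show ?thesis by simp
qed


section \<open>Eulerian numbers\<close>

text \<open>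
  For \<open>m \<ge> 1\<close> this is the number of permutations of \<open>m\<close> elements with \<open>i - 1\<close> descents.
  The shift by one, and the value \<open>1\<close> at \<open>i = 1\<close> for \<open>m = 0\<close>, make these the numerator
  coefficients of the sum of \<open>i ^ m * x ^ i\<close> over \<open>i \<ge> 1\<close>, uniformly in \<open>m\<close>.
\<close>
fun eulerian :: "nat \<Rightarrow> nat \<Rightarrow> nat" where
  "eulerian 0 i = of_bool (i = 1)"
| "eulerian (Suc m) 0 = 0"
| "eulerian (Suc m) (Suc i) = Suc i * eulerian m (Suc i) + (Suc m - i) * eulerian m i"

lemma eulerian_eq_0: "i > max m 1 \<Longrightarrow> eulerian m i = 0"
  by (induction m i rule: eulerian.induct) auto

lemma eulerian_pos: "1 \<le> i \<Longrightarrow> i \<le> max m 1 \<Longrightarrow> eulerian m i > 0"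
proof (induction m i rule: eulerian.induct)
  case (3 m i)
  show ?case
  proof (cases "Suc i \<le> max m 1")
    case True
    then show ?thesis using 3 by simp
  next
    case False
    then have "i = m" "1 \<le> i" using 3 by auto
    then show ?thesis using 3 by simp
  qed
qed auto

text \<open>
  The sum starts at \<open>i = 1\<close> also for \<open>m = 0\<close>, where \<open>0 ^ 0 = 1\<close> would otherwise
  contribute a constant term.
\<close>
definition powers_fps :: "nat \<Rightarrow> rat fps" where
  "powers_fps m = Abs_fps (\<lambda>i. if i = 0 then 0 else of_nat i ^ m)"

definition eulerian_fps :: "nat \<Rightarrow> rat fps" where
  "eulerian_fps m = Abs_fps (\<lambda>i. of_nat (eulerian m i))"

lemma eulerian_fps_Suc:
  "eulerian_fps (Suc m) = fps_X * ((1 - fps_X) * fps_deriv (eulerian_fps m) + of_nat (Suc m) * eulerian_fps m)"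
proof (rule fps_ext)
  fix i
  show "fps_nth (eulerian_fps (Suc m)) i = fps_nth (fps_X * ((1 - fps_X) * fps_deriv (eulerian_fps m) + of_nat (Suc m) * eulerian_fps m)) i"
  proof (cases i)
    case 0
    then show ?thesis by (simp add: eulerian_fps_def)
  next
    case (Suc j)
    define e where "e i = (of_nat (eulerian m i) :: rat)" for i
    \<comment> \<open>Truncated subtraction is harmless: when \<open>j > Suc m\<close> the factor \<open>eulerian m j\<close> vanishes.\<close>
    have e: "of_nat ((Suc m - j) * eulerian m j) = (of_nat (Suc m) - of_nat j) * e j"
      by (cases "j \<le> Suc m") (simp_all add: of_nat_diff eulerian_eq_0 e_def)
    have "fps_nth (eulerian_fps (Suc m)) (Suc j) = of_nat (Suc j) * e (Suc j) + (of_nat (Suc m) - of_nat j) * e j"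
      unfolding e [symmetric] by (simp only: eulerian_fps_def e_def fps_nth_Abs_fps eulerian.simps of_nat_add of_nat_mult)
    also have "\<dots> = of_nat (Suc j) * e (Suc j) - of_nat j * e j + of_nat (Suc m) * e j"
      by (simp add: algebra_simps)
    also have "\<dots> = fps_nth (fps_X * ((1 - fps_X) * fps_deriv (eulerian_fps m) + of_nat (Suc m) * eulerian_fps m)) (Suc j)"
      by (cases j) (simp_all add: eulerian_fps_def e_def left_diff_distrib flip: fps_of_nat del: of_nat_Suc)
    finally show ?thesis unfolding Suc .
  qed
qed

text \<open>
  Both sides satisfy the recurrence given by the operator \<open>x * d / dx\<close>, which raises the
  exponent \<open>m\<close> by one.
\<close>
lemma powers_fps_mult_power: "(1 - fps_X) ^ Suc m * powers_fps m = eulerian_fps m"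
proof (induction m)
  case 0
  show ?case
  proof (rule fps_ext)
    fix i
    show "fps_nth ((1 - fps_X) ^ Suc 0 * powers_fps 0) i = fps_nth (eulerian_fps 0) i"
      by (cases i) (auto simp: powers_fps_def eulerian_fps_def left_diff_distrib)
  qed
next
  case (Suc m)
  have P: "powers_fps (Suc m) = fps_X * fps_deriv (powers_fps m)"
  proof (rule fps_ext)
    fix i
    show "fps_nth (powers_fps (Suc m)) i = fps_nth (fps_X * fps_deriv (powers_fps m)) i"
      by (cases i) (auto simp: powers_fps_def)
  qed
  have E: "fps_deriv (eulerian_fps m) = (1 - fps_X) ^ Suc m * fps_deriv (powers_fps m)
      - of_nat (Suc m) * (1 - fps_X) ^ m * powers_fps m"
    unfolding Suc.IH [symmetric]
    by (simp add: fps_deriv_power' algebra_simps del: power_Suc of_nat_Suc)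
  have "x * (q * (q ^ Suc m * d - c * q ^ m * p) + c * (q ^ Suc m * p)) = q ^ Suc (Suc m) * (x * d)"
    for x q d c p :: "rat fps"
    by (simp add: algebra_simps)
  then show ?case
    unfolding eulerian_fps_Suc E P by (simp only: Suc.IH [symmetric])
qed


section \<open>Positivity of the coefficients\<close>

text \<open>
  The rising factor \<open>y * (y + 1) * \<dots> * (y + n - j - 1)\<close> is nonempty as \<open>j < n\<close>, so
  it accounts for one factor \<open>y\<close>.
\<close>
lemma ratio_power_coeff_eq_signed_binomial_poly:
  assumes "j < n"
  shows "smult (of_nat n) (ratio_power_coeff n j) = pCons 0 (signed_binomial_poly n j)"
proof -
  have "n - j = Suc (n - 1 - j)" using assms by simp
  then have "pochhammer [:0, 1 :: rat:] (n - j) = [:0, 1:] * pochhammer [:1, 1:] (n - 1 - j)"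
    by (simp only: pochhammer_rec) (simp add: one_pCons)
  then show ?thesis
    by (simp add: ratio_power_coeff_def signed_binomial_poly_def)
qed

text \<open>
  The coefficient is \<open>n\<close> times a convolution, over \<open>j < k\<close>, of the coefficients of
  \<open>y ^ (m + 1)\<close> in \<^const>\<open>ratio_power_coeff\<close> with the powers \<open>(k - j) ^ m\<close>. In terms of
  generating functions in \<open>x\<close>, the factor \<open>(1 - x) ^ (m + 1)\<close> of the former cancels the
  denominator of the latter.
\<close>
lemma coeff_hypersimplex_ehrhart:
  assumes "k \<le> n"
  shows "coeff (hypersimplex_ehrhart n k) m = of_nat n * fps_nth (weighted_lah n (Suc m) * eulerian_fps m) k"
proof -
  let ?M = "Abs_fps (\<lambda>j. if j \<le> n then coeff (ratio_power_coeff n j) (Suc m) else 0)"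
  have "coeff (signed_binomial_poly n j) m = of_nat n * coeff (ratio_power_coeff n j) (Suc m)" if "j < n" for j
    using arg_cong[OF ratio_power_coeff_eq_signed_binomial_poly[OF that], of "\<lambda>p. coeff p (Suc m)"] by simp
  then have "coeff (hypersimplex_ehrhart n k) m = of_nat n * (\<Sum>j<k. coeff (ratio_power_coeff n j) (Suc m) * of_nat (k - j) ^ m)"
    using assms unfolding hypersimplex_ehrhart_def coeff_sum sum_distrib_left
    by (intro sum.cong refl) (simp add: coeff_pcompose_linear mult_ac)
  \<comment> \<open>The term \<open>j = k\<close> is harmless because \<open>powers_fps m\<close> has no constant term, even for \<open>m = 0\<close>.\<close>
  also have "(\<Sum>j<k. coeff (ratio_power_coeff n j) (Suc m) * of_nat (k - j) ^ m) = (\<Sum>j\<le>k. fps_nth ?M j * fps_nth (powers_fps m) (k - j))"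
    using assms by (intro sum.mono_neutral_cong_left) (auto simp: powers_fps_def)
  also have "\<dots> = fps_nth (?M * powers_fps m) k"
    by (simp add: fps_mult_nth atLeast0AtMost)
  also have "?M * powers_fps m = weighted_lah n (Suc m) * eulerian_fps m"
    unfolding ratio_power_coeff_eq_weighted_lah powers_fps_mult_power [symmetric] by (simp only: mult_ac)
  finally show ?thesis .
qed

lemma coeff_hypersimplex_ehrhart_pos:
  assumes "1 \<le> k" "k < n" "m < n"
  shows "coeff (hypersimplex_ehrhart n k) m > 0"
proof -
  \<comment> \<open>The factors have positive coefficients for exponents up to \<open>n - 1 - m\<close> and from \<open>1\<close> to \<open>max m 1\<close>; this \<open>i\<close> splits \<open>k\<close> accordingly.\<close>
  define i where "i = min (k - 1) (n - 1 - m)"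
  have "1 \<le> k - i" "k - i \<le> max m 1" "i + Suc m \<le> n" "i \<le> k"
    using assms by (auto simp: i_def min_def max_def)
  then have "fps_nth (weighted_lah n (Suc m)) i * fps_nth (eulerian_fps m) (k - i) > 0"
    by (intro mult_pos_pos) (simp_all add: weighted_lah_pos eulerian_pos eulerian_fps_def)
  then have "(\<Sum>i=0..k. fps_nth (weighted_lah n (Suc m)) i * fps_nth (eulerian_fps m) (k - i)) > 0"
    using \<open>i \<le> k\<close> by (intro sum_pos2[of _ i]) (auto simp: weighted_lah_nonneg eulerian_fps_def)
  then show ?thesis
    using assms by (simp add: coeff_hypersimplex_ehrhart fps_mult_nth)
qed

text \<open>
  There are no partitions of \<open>n\<close> elements into more than \<open>n\<close> blocks.
\<close>
lemma degree_hypersimplex_ehrhart: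
  assumes "1 \<le> k" "k < n"
  shows "degree (hypersimplex_ehrhart n k) < n"
  using assms by (intro degree_lessI) (auto simp: coeff_hypersimplex_ehrhart weighted_lah_eq_0)

theorem theorem1p2:
  fixes k :: nat
  assumes "1 \<le> k" and "k \<le> CARD('n::finite)"
  shows "\<forall>m \<le> degree (ehrhart_polynomial (hypersimplex k :: (real ^ 'n) set)).
           coeff (ehrhart_polynomial (hypersimplex k :: (real ^ 'n) set)) m > 0"
proof (cases "k = CARD('n)")
  case True
  have "ehrhart_polynomial (hypersimplex k :: (real ^ 'n) set) = 1"
    unfolding True by (rule ehrhart_polynomial_eqI[OF is_ehrhart_polynomial_hypersimplex_full])
  then show ?thesis by simp
next
  case False
  then have k: "1 \<le> k" "k < CARD('n)" using assms by auto
  have "ehrhart_polynomial (hypersimplex k :: (real ^ 'n) set) = hypersimplex_ehrhart CARD('n) k"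
    using assms by (intro ehrhart_polynomial_eqI is_ehrhart_polynomial_hypersimplex_ehrhart)
  then show ?thesis
    using degree_hypersimplex_ehrhart[OF k] coeff_hypersimplex_ehrhart_pos[OF k] by simp
qed

end
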